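(* For $n\ge1$ and distinct variables $v_1,\dots,v_n$, let $T_n$ be as defined in the context. Then: (1) $n(T_n)=3n-4$ for $n\ge2$; (2) $c(T_n)=8n-12$ for $n\ge2$; (3) $\ell(T_n)=24n-40$ for $n\ge2$; (4) $T_n$ is unsatisfiable and all its clauses have length at most $3$; (5) for $n\ge3$, $\mathrm{whd}(T_n)=\mathrm{wid}(T_n)=3$; (6) for $n\ge 2$ there exists a resolution refutation of $T_n$ using altogether $18n-29$ clauses.
   Context: Literals, clauses (finite sets of literals without complementary pairs), clause-sets; $n(F)=|\mathrm{var}(F)|$, $c(F)=|F|$, $\ell(F)=\sum_{C\in F}|C|$. Resolution: clauses $C,D$ with $C\cap\overline D=\{x\}$ (exactly one clashing literal) have resolvent $(C\cup D)\setminus\{x,\overline x\}$; a resolution refutation of $F$ is a resolution tree with leaves in $F$ deriving the empty clause $\bot$. For unsatisfiable $F$: $\mathrm{whd}(F)$ is the minimal $k$ such that $F$ has a resolution refutation where every resolution step has at least one parent of length $\le k$; $\mathrm{wid}(F)$ is the minimal $k$ such that $F$ has a resolution refutation all of whose clauses (axioms and resolvents) have length $\le k$. For an XOR-clause $C$ (a clause read as $\bigoplus_{x\in C}x=0$ over $\mathbb{Z}_2$), $X_0(C)$ is the set of all clauses $D$ with $\mathrm{var}(D)=\mathrm{var}(C)$ whose number of complemented literals has parity different from that of $C$. Let $C_1=\{v_1,\dots,v_n\}$ and $C_2=\{v_1,\dots,v_{n-1},\overline{v_n}\}$. $T_n:=X_1(\{C_1,C_2\})$, i.e. for $n\le2$,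 $T_n=X_0(C_1)\cup X_0(C_2)$, and for $n\ge3$, with new distinct variables $y_2,\dots,y_{n-1},y_2',\dots,y_{n-1}'$, $T_n$ is the union of $X_0(E)$ over the XOR-clauses $E$ in $\{v_1,v_2,y_2\}$, $\{y_{i-1},v_i,y_i\}$ ($3\le i\le n-1$), $\{y_{n-1},v_n\}$, $\{v_1,v_2,y_2'\}$, $\{y'_{i-1},v_i,y'_i\}$ ($3\le i\le n-1$), $\{y'_{n-1},\overline{v_n}\}$. *)

theory Defs
  imports Main
begin

datatype 'v literal = Pos 'v | is_neg: Neg 'v

primrec var_lit :: "'v literal \<Rightarrow> 'v" where
  "var_lit (Pos x) = x"
| "var_lit (Neg x) = x"

primrec compl_lit :: "'v literal \<Rightarrow> 'v literal" where
  "compl_lit (Pos x) = Neg x"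
| "compl_lit (Neg x) = Pos x"

type_synonym 'v clause = "'v literal set"

type_synonym 'v clause_set = "'v clause set"

definition is_clause :: "'v clause \<Rightarrow> bool" where
  "is_clause C \<longleftrightarrow> finite C \<and> C \<inter> compl_lit ` C = {}"

definition vars_clause :: "'v clause \<Rightarrow> 'v set" where
  "vars_clause C = var_lit ` C"

definition num_vars :: "'v clause_set \<Rightarrow> nat" where
  "num_vars F = card (\<Union>C\<in>F. vars_clause C)"

definition num_clauses :: "'v clause_set \<Rightarrow> nat" where
  "num_clauses F = card F"

definition num_lit_occs :: "'v clause_set \<Rightarrow> nat" where
  "num_lit_occs F = (\<Sum>C\<in>F. card C)"

primrec lit_true :: "('v \<Rightarrow> bool) \<Rightarrow> 'v literal \<Rightarrow> bool" where
  "lit_true \<phi> (Pos x) \<longleftrightarrow> \<phi> x"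
| "lit_true \<phi> (Neg x) \<longleftrightarrow> \<not> \<phi> x"

definition satisfiable :: "'v clause_set \<Rightarrow> bool" where
  "satisfiable F \<longleftrightarrow> (\<exists>\<phi>. \<forall>C\<in>F. \<exists>l\<in>C. lit_true \<phi> l)"

definition is_resolvent :: "'v clause \<Rightarrow> 'v clause \<Rightarrow> 'v clause \<Rightarrow> bool" where
  "is_resolvent C D R \<longleftrightarrow> is_clause C \<and> is_clause D \<and>
     (\<exists>x. C \<inter> compl_lit ` D = {x} \<and> R = (C \<union> D) - {x, compl_lit x})"

text \<open>Binary trees with every node labelled by a clause: \<open>concl\<close> is the label of the root,
  \<open>labels\<close> the set of all labels, so a clause occurring at several nodes is counted only once
  in \<open>card (labels t)\<close>.\<close>

datatype (labels: 'c) res_tree =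
  Leaf (concl: 'c)
| Resolve (concl: 'c) "'c res_tree" "'c res_tree"

primrec resolution_tree :: "'v clause_set \<Rightarrow> 'v clause res_tree \<Rightarrow> bool" where
  "resolution_tree F (Leaf C) \<longleftrightarrow> C \<in> F"
| "resolution_tree F (Resolve R s t) \<longleftrightarrow>
     resolution_tree F s \<and> resolution_tree F t \<and> is_resolvent (concl s) (concl t) R"

definition refutation :: "'v clause_set \<Rightarrow> 'v clause res_tree \<Rightarrow> bool" where
  "refutation F t \<longleftrightarrow> resolution_tree F t \<and> concl t = {}"

primrec parent_bounded :: "nat \<Rightarrow> 'v clause res_tree \<Rightarrow> bool" where
  "parent_bounded k (Leaf C) \<longleftrightarrow> True"
| "parent_bounded k (Resolve R s t) \<longleftrightarrow>
     parent_bounded k s \<and> parent_bounded k t \<and> (card (concl s) \<le> k \<or> card (concl t) \<le> k)"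

text \<open>The two width measures are meaningful only for unsatisfiable \<open>F\<close>; if \<open>F\<close> has no
  refutation, the \<open>LEAST\<close> operator returns an unspecified number.\<close>

definition whd :: "'v clause_set \<Rightarrow> nat" where
  "whd F = (LEAST k. \<exists>t. refutation F t \<and> parent_bounded k t)"

definition wid :: "'v clause_set \<Rightarrow> nat" where
  "wid F = (LEAST k. \<exists>t. refutation F t \<and> (\<forall>C\<in>labels t. card C \<le> k))"

definition X0 :: "'v clause \<Rightarrow> 'v clause_set" where
  "X0 C = {D. is_clause D \<and> vars_clause D = vars_clause C \<and>
              (even (card {l \<in> D. is_neg l}) \<longleftrightarrow> odd (card {l \<in> C. is_neg l}))}"

text \<open>The variables are the values \<open>v i\<close> for \<open>1 \<le> i \<le> n\<close> and \<open>y i\<close>, \<open>y' i\<close> for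
  \<open>2 \<le> i \<le> n - 1\<close>; other values of these functions, and the case \<open>n = 0\<close>, are irrelevant.\<close>

definition T :: "(nat \<Rightarrow> 'v) \<Rightarrow> (nat \<Rightarrow> 'v) \<Rightarrow> (nat \<Rightarrow> 'v) \<Rightarrow> nat \<Rightarrow> 'v clause_set" where
  "T v y y' n =
     (if n \<le> 2
      then X0 ((\<lambda>i. Pos (v i)) ` {1..n}) \<union>
           X0 ((\<lambda>i. Pos (v i)) ` {1..n - 1} \<union> {Neg (v n)})
      else (\<Union>E \<in>
             {{Pos (v 1), Pos (v 2), Pos (y 2)}} \<union>
             {{Pos (y (i - 1)), Pos (v i), Pos (y i)} | i. 3 \<le> i \<and> i \<le> n - 1} \<union>
             {{Pos (y (n - 1)), Pos (v n)}} \<union>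
             {{Pos (v 1), Pos (v 2), Pos (y' 2)}} \<union>
             {{Pos (y' (i - 1)), Pos (v i), Pos (y' i)} | i. 3 \<le> i \<and> i \<le> n - 1} \<union>
             {{Pos (y' (n - 1)), Neg (v n)}}. X0 E))"

end

theory Submission
  imports Defs
begin

text \<open>The refutation propagates \<open>y\<^sub>k \<noteq> y'\<^sub>k\<close> downwards: it holds for \<open>k = n - 1\<close> by the two binary
  constraints, passes from \<open>k + 1\<close> to \<open>k\<close> because both chains add the same \<open>v\<^sub>k\<^sub>+\<^sub>1\<close>, and for
  \<open>k = 2\<close> it contradicts \<open>v\<^sub>1 + v\<^sub>2 = y\<^sub>2 = y'\<^sub>2\<close>. All clauses have at most three
  literals, and each level contributes exactly 18 clauses, all of them containing a variable not
  used at higher levels.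

  For the lower bound, solve the binary constraints for \<open>y\<^sub>n\<^sub>-\<^sub>1\<close> and \<open>y'\<^sub>n\<^sub>-\<^sub>1\<close>. Each axiom then becomes
  tautological or has three distinct variables, and this survives every resolution step
  with a parent of length at most 2, but fails for the empty clause.\<close>

subsection \<open>Resolution\<close>

lemma compl_compl [simp]: "compl_lit (compl_lit l) = l"
  by (cases l) auto

lemma compl_ne [simp]: "compl_lit l \<noteq> l" "l \<noteq> compl_lit l"
  by (cases l; simp)+

lemma mem_compl_image: "l \<in> compl_lit ` D \<longleftrightarrow> compl_lit l \<in> D"
  by (metis compl_compl image_iff)

lemma is_clause_iff: "is_clause C \<longleftrightarrow> finite C \<and> (\<forall>l\<in>C. compl_lit l \<notin> C)"
  by (auto simp: is_clause_def mem_compl_image disjoint_iff)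

lemma is_clause_empty [simp]: "is_clause {}"
  by (simp add: is_clause_def)

lemma is_clause_insert [simp]:
  "is_clause (insert l C) \<longleftrightarrow> is_clause C \<and> compl_lit l \<notin> C"
  by (auto simp: is_clause_iff)

lemma vars_clause_empty [simp]: "vars_clause {} = {}"
  and vars_clause_insert [simp]: "vars_clause (insert l C) = insert (var_lit l) (vars_clause C)"
  by (simp_all add: vars_clause_def)

text \<open>The pivot is named explicitly, so that uniqueness of the clash in a concrete step
  reduces to distinctness of a few variables.\<close>

lemma is_resolventI:
  assumes "is_clause C" "is_clause D" "x \<in> C" "compl_lit x \<in> D"
    and "\<forall>l\<in>C. l \<noteq> x \<longrightarrow> compl_lit l \<notin> D"
    and "(C \<union> D) - {x, compl_lit x} = R"
  shows "is_resolvent C D R"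
proof -
  have "C \<inter> compl_lit ` D = {x}"
    using assms by (auto simp: mem_compl_image)
  then show ?thesis
    using assms unfolding is_resolvent_def by blast
qed

lemma is_resolventE:
  assumes "is_resolvent C D R"
  obtains x where "is_clause C" "is_clause D" "x \<in> C" "compl_lit x \<in> D"
    "R = (C \<union> D) - {x, compl_lit x}"
proof -
  obtain x where x: "C \<inter> compl_lit ` D = {x}" "R = (C \<union> D) - {x, compl_lit x}"
    using assms unfolding is_resolvent_def by blast
  then have "x \<in> C" "compl_lit x \<in> D"
    by (metis IntD1 IntD2 insertI1 mem_compl_image)+
  with x show ?thesis
    using assms that unfolding is_resolvent_def by blast
qed

text \<open>One of the two clashing literals is false under \<open>\<phi>\<close>; the parent
  containing it is satisfied by another literal, which survives in the resolvent.\<close>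

lemma resolution_sound:
  assumes "resolution_tree F t" "\<forall>C\<in>F. \<exists>l\<in>C. lit_true \<phi> l"
  shows "\<exists>l\<in>concl t. lit_true \<phi> l"
  using assms(1)
proof (induction t)
  case (Leaf C)
  then show ?case using assms(2) by simp
next
  case (Resolve R s t)
  have neg: "lit_true \<phi> (compl_lit l) \<longleftrightarrow> \<not> lit_true \<phi> l" for l
    by (cases l) auto
  from Resolve.prems have "is_resolvent (concl s) (concl t) R" by simp
  then obtain x where x: "is_clause (concl s)" "is_clause (concl t)" "x \<in> concl s"
    "compl_lit x \<in> concl t" "R = (concl s \<union> concl t) - {x, compl_lit x}"
    by (rule is_resolventE)
  obtain l m where lm: "l \<in> concl s" "lit_true \<phi> l" "m \<in> concl t" "lit_true \<phi> m"
    using Resolve by auto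
  show ?case
  proof (cases "lit_true \<phi> x")
    case True
    then have "m \<noteq> compl_lit x" "m \<noteq> x"
      using lm neg x(2,4) by (auto simp: is_clause_iff)
    then show ?thesis using lm x(5) by auto
  next
    case False
    then have "l \<noteq> compl_lit x" "l \<noteq> x"
      using lm x(1,3) by (auto simp: is_clause_iff)
    then show ?thesis using lm x(5) by auto
  qed
qed

lemma refutation_unsat: "refutation F t \<Longrightarrow> \<not> satisfiable F"
  unfolding refutation_def satisfiable_def using resolution_sound by fastforce

lemma concl_in_labels [simp]: "concl t \<in> labels t"
  by (cases t) auto

lemma finite_labels [simp]: "finite (labels t)"
  by (induction t) auto

text \<open>Links the two measures: a refutation of width \<open>k\<close> also competes for
  \<open>whd\<close>, so an upper bound for \<open>wid\<close> and a lower bound for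
  \<open>whd\<close> settle both.\<close>

lemma parent_bounded_if_width:
  "\<forall>C\<in>labels t. card C \<le> k \<Longrightarrow> parent_bounded k t"
  by (induction t) auto

lemma parent_bounded_mono: "parent_bounded k t \<Longrightarrow> k \<le> k' \<Longrightarrow> parent_bounded k' t"
  by (induction t) auto

subsection \<open>An invariant of resolution with a short parent\<close>

text \<open>For a substitution of literals that commutes with complementation, having a
  blocked image is preserved by every resolution step with a parent of length at most 2: such a
  parent can only be blocked by being an equivalence (mapped to a complementary pair), and then
  resolving with it leaves the image of the other parent intact.\<close>

definition blocked :: "'v literal set \<Rightarrow> bool" where
  "blocked S \<longleftrightarrow> card S \<ge> 3 \<or> (\<exists>l\<in>S. compl_lit l \<in> S)"

lemma blocked_mono: "blocked S \<Longrightarrow> S \<subseteq> S' \<Longrightarrow> finite S' \<Longrightarrow> blocked S'"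
  unfolding blocked_def by (meson card_mono le_trans subsetD)

lemma blocked_resolvent:
  assumes \<sigma>: "\<And>l. \<sigma> (compl_lit l) = compl_lit (\<sigma> l)"
    and "is_clause C" "is_clause D" "x \<in> C" "compl_lit x \<in> D"
    and R: "R = (C \<union> D) - {x, compl_lit x}"
    and "blocked (\<sigma> ` C)" "blocked (\<sigma> ` D)" "card C \<le> 2"
  shows "blocked (\<sigma> ` R)"
proof -
  have fin: "finite C" "finite D"
    using assms by (auto simp: is_clause_iff)
  have "card (\<sigma> ` C) \<le> 2"
    using card_image_le[OF fin(1)] assms(9) le_trans by blast
  then obtain l m where lm: "l \<in> C" "m \<in> C" "\<sigma> m = compl_lit (\<sigma> l)"
    using assms(7) unfolding blocked_def by auto
  then have "l \<noteq> m" by auto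
  have "C = {l, m}"
    using card_seteq[OF fin(1), of "{l, m}"] lm \<open>l \<noteq> m\<close> assms(9) by auto
  \<comment> \<open>\<open>x\<close> is one of the two literals of \<open>C\<close>;
    \<open>z\<close> is the other one, and it stays in the resolvent.\<close>
  then obtain z where z: "z \<in> C" "z \<noteq> x" "\<sigma> z = compl_lit (\<sigma> x)"
    using lm \<open>l \<noteq> m\<close> \<open>x \<in> C\<close> by auto
  have "z \<noteq> compl_lit x" using z(1) assms(2,4) by (auto simp: is_clause_iff)
  then have "z \<in> R" using z R by auto
  have "x \<notin> D" using assms(3,5) by (auto simp: is_clause_iff)
  \<comment> \<open>The removed literal \<open>compl_lit x\<close> has the same image as
    \<open>z\<close>, so nothing is lost from the image of \<open>D\<close>.\<close>
  have "\<sigma> d \<in> \<sigma> ` R" if "d \<in> D" for d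
  proof (cases "d = compl_lit x")
    case True
    then show ?thesis using z(3) \<open>z \<in> R\<close> \<sigma> by (metis image_eqI)
  next
    case False
    then show ?thesis using that \<open>x \<notin> D\<close> R by auto
  qed
  then have "\<sigma> ` D \<subseteq> \<sigma> ` R" by blast
  moreover have "finite (\<sigma> ` R)" using fin R by simp
  ultimately show ?thesis using assms(8) blocked_mono by blast
qed

lemma parent_bounded_2_blocked:
  assumes \<sigma>: "\<And>l. \<sigma> (compl_lit l) = compl_lit (\<sigma> l)"
    and F: "\<And>C. C \<in> F \<Longrightarrow> blocked (\<sigma> ` C)"
    and "resolution_tree F t" "parent_bounded 2 t"
  shows "blocked (\<sigma> ` concl t)"
  using assms(3,4)
proof (induction t)
  case (Leaf C)
  then show ?case using F by simp
next
  case (Resolve R s t)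
  then have b: "blocked (\<sigma> ` concl s)" "blocked (\<sigma> ` concl t)" by simp_all
  from Resolve.prems have "is_resolvent (concl s) (concl t) R" by simp
  then obtain x where x: "is_clause (concl s)" "is_clause (concl t)" "x \<in> concl s"
    "compl_lit x \<in> concl t" "R = (concl s \<union> concl t) - {x, compl_lit x}"
    by (rule is_resolventE)
  \<comment> \<open>The same step read with the parents exchanged, since
    \<open>blocked_resolvent\<close> expects the short parent first.\<close>
  have x': "compl_lit (compl_lit x) \<in> concl s"
    "R = (concl t \<union> concl s) - {compl_lit x, compl_lit (compl_lit x)}"
    using x by auto
  from Resolve.prems have "card (concl s) \<le> 2 \<or> card (concl t) \<le> 2" by simp
  then show ?case
    using blocked_resolvent[OF \<sigma> x b] blocked_resolvent[OF \<sigma> x(2,1,4) x' b(2,1)] by auto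
qed

subsection \<open>Clauses of short XOR-constraints\<close>

text \<open>The clauses with an odd number of negations state that the sum of the variables is 0,
  those with an even number that it is 1.\<close>

definition odd2 :: "'v \<Rightarrow> 'v \<Rightarrow> 'v clause_set" where
  "odd2 a b = {{Neg a, Pos b}, {Pos a, Neg b}}"

definition ev2 :: "'v \<Rightarrow> 'v \<Rightarrow> 'v clause_set" where
  "ev2 a b = {{Pos a, Pos b}, {Neg a, Neg b}}"

definition odd3 :: "'v \<Rightarrow> 'v \<Rightarrow> 'v \<Rightarrow> 'v clause_set" where
  "odd3 a b c = {{Neg a, Pos b, Pos c}, {Pos a, Neg b, Pos c}, {Pos a, Pos b, Neg c},
     {Neg a, Neg b, Neg c}}"

definition ev3 :: "'v \<Rightarrow> 'v \<Rightarrow> 'v \<Rightarrow> 'v clause_set" where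
  "ev3 a b c = {{Pos a, Pos b, Pos c}, {Pos a, Neg b, Neg c}, {Neg a, Pos b, Neg c},
     {Neg a, Neg b, Pos c}}"

text \<open>Not a parity class: the sign of \<open>c\<close> is free, so this is
  \<open>a + b = 1\<close> expanded over \<open>c\<close>.\<close>

definition ev2_weak :: "'v \<Rightarrow> 'v \<Rightarrow> 'v \<Rightarrow> 'v clause_set" where
  "ev2_weak a b c = {{Pos a, Pos b, Pos c}, {Pos a, Pos b, Neg c}, {Neg a, Neg b, Pos c},
     {Neg a, Neg b, Neg c}}"

lemmas parity_defs = odd2_def ev2_def odd3_def ev3_def ev2_weak_def

text \<open>Separates the choice of signs from the parity condition in \<open>X0\<close>, so that
  clauses can be enumerated one variable at a time.\<close>

definition clauses_over :: "'v set \<Rightarrow> 'v clause_set" where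
  "clauses_over V = {D. is_clause D \<and> vars_clause D = V}"

lemma clauses_over_empty: "clauses_over {} = {{}}"
  by (auto simp: clauses_over_def vars_clause_def)

text \<open>A clause over \<open>insert a V\<close> contains exactly one of the two literals of
  \<open>a\<close>, and removing it leaves a clause over \<open>V\<close>. Repeated rewriting lists
  the clauses of a concrete \<open>X0\<close>.\<close>

lemma clauses_over_insert:
  assumes "a \<notin> V"
  shows "clauses_over (insert a V) =
    insert (Pos a) ` clauses_over V \<union> insert (Neg a) ` clauses_over V"
proof
  show "clauses_over (insert a V) \<subseteq>
    insert (Pos a) ` clauses_over V \<union> insert (Neg a) ` clauses_over V"
  proof
    fix D assume D: "D \<in> clauses_over (insert a V)"
    define E where "E = {l \<in> D. var_lit l \<noteq> a}"
    have "a \<in> var_lit ` D" using D by (auto simp: clauses_over_def vars_clause_def)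
    then obtain l where l: "l \<in> D" "var_lit l = a" by auto
    have only: "m = l" if "m \<in> D" "var_lit m = a" for m
      using that l D by (cases l; cases m) (auto simp: clauses_over_def is_clause_iff)
    have "D = insert l E" using l only unfolding E_def by blast
    moreover have "E \<in> clauses_over V"
      using D assms unfolding E_def clauses_over_def is_clause_iff vars_clause_def
      by (auto simp: set_eq_iff image_iff)
    moreover have "l = Pos a \<or> l = Neg a" using l(2) by (cases l) auto
    ultimately show "D \<in> insert (Pos a) ` clauses_over V \<union> insert (Neg a) ` clauses_over V"
      by blast
  qed
next
  show "insert (Pos a) ` clauses_over V \<union> insert (Neg a) ` clauses_over V
    \<subseteq> clauses_over (insert a V)"
    using assms unfolding clauses_over_def vars_clause_def by force
qed

definition odd_neg :: "'v clause \<Rightarrow> bool" where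
  "odd_neg C \<longleftrightarrow> odd (card {l \<in> C. is_neg l})"

lemma odd_neg_empty [simp]: "\<not> odd_neg {}"
  by (simp add: odd_neg_def)

lemma odd_neg_insert [simp]:
  assumes "finite C" "l \<notin> C"
  shows "odd_neg (insert l C) \<longleftrightarrow> odd_neg C \<noteq> is_neg l"
proof -
  have "{m \<in> insert l C. is_neg m} =
    (if is_neg l then insert l {m \<in> C. is_neg m} else {m \<in> C. is_neg m})"
    by auto
  then show ?thesis using assms by (simp add: odd_neg_def)
qed

lemma X0_eq: "X0 C = clauses_over (vars_clause C) \<inter> {D. odd_neg D \<noteq> odd_neg C}"
  by (auto simp: X0_def clauses_over_def odd_neg_def)

lemmas X0_simps = X0_eq clauses_over_insert clauses_over_empty Int_insert_left

lemma X0_1: "X0 {Pos a} = {{Neg a}}" "X0 {Neg a} = {{Pos a}}"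
  by (simp_all add: X0_simps)

text \<open>Complementing one literal flips the required parity, which turns
  \<open>a + b = 0\<close> into \<open>a + b = 1\<close>.\<close>

lemma X0_2: "a \<noteq> b \<Longrightarrow> X0 {Pos a, Pos b} = odd2 a b"
  "a \<noteq> b \<Longrightarrow> X0 {Pos a, Neg b} = ev2 a b"
  by (auto simp: X0_simps parity_defs)

lemma X0_3: "distinct [a, b, c] \<Longrightarrow> X0 {Pos a, Pos b, Pos c} = odd3 a b c"
  by (auto simp: X0_simps parity_defs)

lemma vars_parity:
  "C \<in> odd2 a b \<Longrightarrow> vars_clause C = {a, b}"
  "C \<in> ev2 a b \<Longrightarrow> vars_clause C = {a, b}"
  "C \<in> odd3 a b c \<Longrightarrow> vars_clause C = {a, b, c}"
  "C \<in> ev3 a b c \<Longrightarrow> vars_clause C = {a, b, c}"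
  "C \<in> ev2_weak a b c \<Longrightarrow> vars_clause C = {a, b, c}"
  by (auto simp: parity_defs)

lemma finite_parity [simp]:
  "finite (odd2 a b)" "finite (ev2 a b)" "finite (odd3 a b c)" "finite (ev3 a b c)"
  "finite (ev2_weak a b c)"
  by (auto simp: parity_defs)

lemma card_parity:
  "a \<noteq> b \<Longrightarrow> card (odd2 a b) = 2"
  "a \<noteq> b \<Longrightarrow> card (ev2 a b) = 2"
  "distinct [a, b, c] \<Longrightarrow> card (odd3 a b c) = 4"
  "distinct [a, b, c] \<Longrightarrow> card (ev3 a b c) = 4"
  "distinct [a, b, c] \<Longrightarrow> card (ev2_weak a b c) = 4"
  by (simp_all add: parity_defs set_eq_subset)

lemma card_clause_parity:
  "C \<in> odd2 a b \<Longrightarrow> a \<noteq> b \<Longrightarrow> card C = 2"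
  "C \<in> ev2 a b \<Longrightarrow> a \<noteq> b \<Longrightarrow> card C = 2"
  "C \<in> odd3 a b c \<Longrightarrow> distinct [a, b, c] \<Longrightarrow> card C = 3"
  "C \<in> ev3 a b c \<Longrightarrow> distinct [a, b, c] \<Longrightarrow> card C = 3"
  "C \<in> ev2_weak a b c \<Longrightarrow> distinct [a, b, c] \<Longrightarrow> card C = 3"
  by (auto simp: parity_defs)

text \<open>Variable sets serve as fingerprints of clause families, which avoids comparing
  individual clauses when counting.\<close>

lemma disjoint_if_vars:
  assumes "\<And>C. C \<in> A \<Longrightarrow> vars_clause C = V" "\<And>C. C \<in> B \<Longrightarrow> vars_clause C = W" "V \<noteq> W"
  shows "A \<inter> B = {}"
  using assms by blast

subsection \<open>Refutation steps\<close>

text \<open>From \<open>c \<noteq> d\<close> and the constraints \<open>a + x + c = 0\<close>, \<open>b + x + d = 0\<close> one derives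
  \<open>b + x + c = 1\<close>, then \<open>a \<noteq> b\<close> weakened by \<open>c\<close> and by its complement, and finally \<open>a \<noteq> b\<close>.\<close>

definition layer_new :: "'v \<Rightarrow> 'v \<Rightarrow> 'v \<Rightarrow> 'v \<Rightarrow> 'v \<Rightarrow> 'v clause_set" where
  "layer_new a b x c d = odd3 a x c \<union> odd3 b x d \<union> ev3 b x c \<union> ev2_weak a b c \<union> ev2 a b"

lemmas label_mem_simps = res_tree.set Un_iff insert_iff empty_iff

text \<open>Since \<open>c \<noteq> d\<close>, the variable \<open>d\<close> can be replaced by the
  complement of \<open>c\<close>: each axiom of \<open>b + x + d = 0\<close> is resolved on
  \<open>d\<close>. The labels are given as one union because shared clauses count once.\<close>

lemma ev3_trees:
  assumes "distinct [b, x, c, d]" "odd3 b x d \<subseteq> F"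
    and s1: "resolution_tree F s1" "concl s1 = {Pos c, Pos d}"
    and s2: "resolution_tree F s2" "concl s2 = {Neg c, Neg d}"
  obtains m1 m2 m3 m4 where
    "resolution_tree F m1" "concl m1 = {Pos b, Pos x, Pos c}"
    "resolution_tree F m2" "concl m2 = {Pos b, Neg x, Neg c}"
    "resolution_tree F m3" "concl m3 = {Neg b, Pos x, Neg c}"
    "resolution_tree F m4" "concl m4 = {Neg b, Neg x, Pos c}"
    "labels m1 \<union> labels m2 \<union> labels m3 \<union> labels m4 =
      labels s1 \<union> labels s2 \<union> odd3 b x d \<union> ev3 b x c"
proof
  let ?m1 = "Resolve {Pos b, Pos x, Pos c} (Leaf {Pos b, Pos x, Neg d}) s1"
  let ?m2 = "Resolve {Pos b, Neg x, Neg c} (Leaf {Pos b, Neg x, Pos d}) s2"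
  let ?m3 = "Resolve {Neg b, Pos x, Neg c} (Leaf {Neg b, Pos x, Pos d}) s2"
  let ?m4 = "Resolve {Neg b, Neg x, Pos c} (Leaf {Neg b, Neg x, Neg d}) s1"
  have F: "{Pos b, Pos x, Neg d} \<in> F" "{Pos b, Neg x, Pos d} \<in> F" "{Neg b, Pos x, Pos d} \<in> F"
    "{Neg b, Neg x, Neg d} \<in> F"
    using assms(2) by (simp_all add: odd3_def)
  have "is_resolvent {Pos b, Pos x, Neg d} {Pos c, Pos d} {Pos b, Pos x, Pos c}"
    by (rule is_resolventI[where x = "Neg d"]) (use assms(1) in auto)
  then show "resolution_tree F ?m1" using F s1 by simp
  have "is_resolvent {Pos b, Neg x, Pos d} {Neg c, Neg d} {Pos b, Neg x, Neg c}"
    by (rule is_resolventI[where x = "Pos d"]) (use assms(1) in auto)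
  then show "resolution_tree F ?m2" using F s2 by simp
  have "is_resolvent {Neg b, Pos x, Pos d} {Neg c, Neg d} {Neg b, Pos x, Neg c}"
    by (rule is_resolventI[where x = "Pos d"]) (use assms(1) in auto)
  then show "resolution_tree F ?m3" using F s2 by simp
  have "is_resolvent {Neg b, Neg x, Neg d} {Pos c, Pos d} {Neg b, Neg x, Pos c}"
    by (rule is_resolventI[where x = "Neg d"]) (use assms(1) in auto)
  then show "resolution_tree F ?m4" using F s1 by simp
  \<comment> \<open>A Boolean identity in membership atoms; no two clauses have to be
    compared.\<close>
  show "labels ?m1 \<union> labels ?m2 \<union> labels ?m3 \<union> labels ?m4 =
      labels s1 \<union> labels s2 \<union> odd3 b x d \<union> ev3 b x c"
    unfolding odd3_def ev3_def by (intro set_eqI, simp only: label_mem_simps) argo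
qed simp_all

lemma layer_trees:
  assumes "distinct [a, b, x, c, d]" "odd3 a x c \<subseteq> F" "odd3 b x d \<subseteq> F"
    and s1: "resolution_tree F s1" "concl s1 = {Pos c, Pos d}"
    and s2: "resolution_tree F s2" "concl s2 = {Neg c, Neg d}"
  obtains t1 t2 where
    "resolution_tree F t1" "concl t1 = {Pos a, Pos b}"
    "resolution_tree F t2" "concl t2 = {Neg a, Neg b}"
    "labels t1 \<union> labels t2 = labels s1 \<union> labels s2 \<union> layer_new a b x c d"
proof -
  have "distinct [b, x, c, d]" using assms(1) by simp
  then obtain m1 m2 m3 m4 where
    m: "resolution_tree F m1" "concl m1 = {Pos b, Pos x, Pos c}"
    "resolution_tree F m2" "concl m2 = {Pos b, Neg x, Neg c}"
    "resolution_tree F m3" "concl m3 = {Neg b, Pos x, Neg c}"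
    "resolution_tree F m4" "concl m4 = {Neg b, Neg x, Pos c}"
    and lab: "labels m1 \<union> labels m2 \<union> labels m3 \<union> labels m4 =
      labels s1 \<union> labels s2 \<union> odd3 b x d \<union> ev3 b x c"
    using ev3_trees[OF _ assms(3) s1 s2] by blast
  \<comment> \<open>Each axiom is paired with the derived clause that has the same sign of
    \<open>c\<close> and the opposite sign of \<open>x\<close>, so \<open>x\<close> is the only
    clash.\<close>
  let ?w1 = "Resolve {Pos a, Pos b, Pos c} (Leaf {Pos a, Neg x, Pos c}) m1"
  let ?w2 = "Resolve {Pos a, Pos b, Neg c} (Leaf {Pos a, Pos x, Neg c}) m2"
  let ?w3 = "Resolve {Neg a, Neg b, Pos c} (Leaf {Neg a, Pos x, Pos c}) m4"
  let ?w4 = "Resolve {Neg a, Neg b, Neg c} (Leaf {Neg a, Neg x, Neg c}) m3"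
  let ?t1 = "Resolve {Pos a, Pos b} ?w1 ?w2"
  let ?t2 = "Resolve {Neg a, Neg b} ?w3 ?w4"
  have F: "{Pos a, Neg x, Pos c} \<in> F" "{Pos a, Pos x, Neg c} \<in> F" "{Neg a, Pos x, Pos c} \<in> F"
    "{Neg a, Neg x, Neg c} \<in> F"
    using assms(2) by (simp_all add: odd3_def)
  have "is_resolvent {Pos a, Neg x, Pos c} {Pos b, Pos x, Pos c} {Pos a, Pos b, Pos c}"
    by (rule is_resolventI[where x = "Neg x"]) (use assms(1) in auto)
  then have w1: "resolution_tree F ?w1" using F m by simp
  have "is_resolvent {Pos a, Pos x, Neg c} {Pos b, Neg x, Neg c} {Pos a, Pos b, Neg c}"
    by (rule is_resolventI[where x = "Pos x"]) (use assms(1) in auto)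
  then have w2: "resolution_tree F ?w2" using F m by simp
  have "is_resolvent {Neg a, Pos x, Pos c} {Neg b, Neg x, Pos c} {Neg a, Neg b, Pos c}"
    by (rule is_resolventI[where x = "Pos x"]) (use assms(1) in auto)
  then have w3: "resolution_tree F ?w3" using F m by simp
  have "is_resolvent {Neg a, Neg x, Neg c} {Neg b, Pos x, Neg c} {Neg a, Neg b, Neg c}"
    by (rule is_resolventI[where x = "Neg x"]) (use assms(1) in auto)
  then have w4: "resolution_tree F ?w4" using F m by simp
  have "is_resolvent {Pos a, Pos b, Pos c} {Pos a, Pos b, Neg c} {Pos a, Pos b}"
    by (rule is_resolventI[where x = "Pos c"]) (use assms(1) in auto)
  then have t1: "resolution_tree F ?t1" using w1 w2 by simp
  have "is_resolvent {Neg a, Neg b, Pos c} {Neg a, Neg b, Neg c} {Neg a, Neg b}"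
    by (rule is_resolventI[where x = "Pos c"]) (use assms(1) in auto)
  then have t2: "resolution_tree F ?t2" using w3 w4 by simp
  have "labels ?t1 \<union> labels ?t2 =
    (labels m1 \<union> labels m2 \<union> labels m3 \<union> labels m4) \<union> odd3 a x c \<union> ev2_weak a b c \<union> ev2 a b"
    unfolding odd3_def ev2_weak_def ev2_def by (intro set_eqI, simp only: label_mem_simps) argo
  then have "labels ?t1 \<union> labels ?t2 = labels s1 \<union> labels s2 \<union> layer_new a b x c d"
    unfolding lab layer_new_def by blast
  then show ?thesis
    using that[OF t1 _ t2] by simp
qed

text \<open>The four clauses exclude all four assignments of \<open>p\<close> and \<open>q\<close>.
  This ends the refutation both for \<open>n = 2\<close> and for \<open>n \<ge> 3\<close>.\<close>

lemma base_tree: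
  assumes "p \<noteq> q"
    and "resolution_tree F s1" "concl s1 = {Pos p, Pos q}"
    and "resolution_tree F s2" "concl s2 = {Neg p, Neg q}"
    and "resolution_tree F s3" "concl s3 = {Pos p, Neg q}"
    and "resolution_tree F s4" "concl s4 = {Neg p, Pos q}"
  obtains t where "refutation F t"
    "labels t = labels s1 \<union> labels s2 \<union> labels s3 \<union> labels s4 \<union> {{Pos p}, {Neg p}, {}}"
proof -
  let ?t = "Resolve {} (Resolve {Pos p} s1 s3) (Resolve {Neg p} s4 s2)"
  have "is_resolvent {Pos p, Pos q} {Pos p, Neg q} {Pos p}"
    by (rule is_resolventI[where x = "Pos q"]) (use assms(1) in auto)
  moreover have "is_resolvent {Neg p, Pos q} {Neg p, Neg q} {Neg p}"
    by (rule is_resolventI[where x = "Pos q"]) (use assms(1) in auto)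
  moreover have "is_resolvent {Pos p} {Neg p} {}"
    by (rule is_resolventI[where x = "Pos p"]) auto
  ultimately have "refutation F ?t"
    using assms by (simp add: refutation_def)
  then show ?thesis by (rule that) (intro set_eqI, simp only: label_mem_simps, argo)
qed

definition final_new :: "'v \<Rightarrow> 'v \<Rightarrow> 'v \<Rightarrow> 'v \<Rightarrow> 'v clause_set" where
  "final_new p q c d = odd3 p q c \<union> odd3 p q d \<union> ev3 p q c \<union> ev2 p q \<union> odd2 p q
    \<union> {{Pos p}, {Neg p}, {}}"

text \<open>The derived \<open>p + q + c = 1\<close> contradicts the axiom
  \<open>p + q + c = 0\<close>: clauses that differ only in the sign of \<open>c\<close> resolve to
  all four clauses over \<open>p\<close> and \<open>q\<close>.\<close>

lemma final_tree:
  assumes "distinct [p, q, c, d]" "odd3 p q c \<subseteq> F" "odd3 p q d \<subseteq> F"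
    and s1: "resolution_tree F s1" "concl s1 = {Pos c, Pos d}"
    and s2: "resolution_tree F s2" "concl s2 = {Neg c, Neg d}"
  obtains t where "refutation F t" "labels t = labels s1 \<union> labels s2 \<union> final_new p q c d"
proof -
  obtain m1 m2 m3 m4 where
    m: "resolution_tree F m1" "concl m1 = {Pos p, Pos q, Pos c}"
    "resolution_tree F m2" "concl m2 = {Pos p, Neg q, Neg c}"
    "resolution_tree F m3" "concl m3 = {Neg p, Pos q, Neg c}"
    "resolution_tree F m4" "concl m4 = {Neg p, Neg q, Pos c}"
    and lab: "labels m1 \<union> labels m2 \<union> labels m3 \<union> labels m4 =
      labels s1 \<union> labels s2 \<union> odd3 p q d \<union> ev3 p q c"
    using ev3_trees[OF assms(1,3) s1 s2] by blast
  let ?u1 = "Resolve {Pos p, Pos q} m1 (Leaf {Pos p, Pos q, Neg c})"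
  let ?u2 = "Resolve {Pos p, Neg q} (Leaf {Pos p, Neg q, Pos c}) m2"
  let ?u3 = "Resolve {Neg p, Pos q} (Leaf {Neg p, Pos q, Pos c}) m3"
  let ?u4 = "Resolve {Neg p, Neg q} m4 (Leaf {Neg p, Neg q, Neg c})"
  have F: "{Pos p, Pos q, Neg c} \<in> F" "{Pos p, Neg q, Pos c} \<in> F" "{Neg p, Pos q, Pos c} \<in> F"
    "{Neg p, Neg q, Neg c} \<in> F"
    using assms(2) by (simp_all add: odd3_def)
  have "is_resolvent {Pos p, Pos q, Pos c} {Pos p, Pos q, Neg c} {Pos p, Pos q}"
    by (rule is_resolventI[where x = "Pos c"]) (use assms(1) in auto)
  then have u1: "resolution_tree F ?u1" using F m by simp
  have "is_resolvent {Pos p, Neg q, Pos c} {Pos p, Neg q, Neg c} {Pos p, Neg q}"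
    by (rule is_resolventI[where x = "Pos c"]) (use assms(1) in auto)
  then have u2: "resolution_tree F ?u2" using F m by simp
  have "is_resolvent {Neg p, Pos q, Pos c} {Neg p, Pos q, Neg c} {Neg p, Pos q}"
    by (rule is_resolventI[where x = "Pos c"]) (use assms(1) in auto)
  then have u3: "resolution_tree F ?u3" using F m by simp
  have "is_resolvent {Neg p, Neg q, Pos c} {Neg p, Neg q, Neg c} {Neg p, Neg q}"
    by (rule is_resolventI[where x = "Pos c"]) (use assms(1) in auto)
  then have u4: "resolution_tree F ?u4" using F m by simp
  have "p \<noteq> q" using assms(1) by simp
  then obtain t where t: "refutation F t"
    "labels t = labels ?u1 \<union> labels ?u4 \<union> labels ?u2 \<union> labels ?u3 \<union> {{Pos p}, {Neg p}, {}}"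
    by (rule base_tree[OF _ u1 _ u4 _ u2 _ u3]) simp_all
  have "labels t = (labels m1 \<union> labels m2 \<union> labels m3 \<union> labels m4) \<union> odd3 p q c
    \<union> ev2 p q \<union> odd2 p q \<union> {{Pos p}, {Neg p}, {}}"
    unfolding t(2) odd3_def ev2_def odd2_def by (intro set_eqI, simp only: label_mem_simps) argo
  then have "labels t = labels s1 \<union> labels s2 \<union> final_new p q c d"
    unfolding lab final_new_def by blast
  then show ?thesis using that t(1) by blast
qed

section \<open>Number of clauses contributed by each step\<close>

lemma odd_neg_parity:
  "a \<noteq> b \<Longrightarrow> C \<in> odd2 a b \<Longrightarrow> odd_neg C"
  "a \<noteq> b \<Longrightarrow> C \<in> ev2 a b \<Longrightarrow> \<not> odd_neg C"
  "distinct [a, b, c] \<Longrightarrow> C \<in> odd3 a b c \<Longrightarrow> odd_neg C"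
  "distinct [a, b, c] \<Longrightarrow> C \<in> ev3 a b c \<Longrightarrow> \<not> odd_neg C"
  by (auto simp: parity_defs)

text \<open>The five families have pairwise different variable sets, so the count is 4 + 4 + 4 + 4 +
  2.\<close>

lemma card_layer_new:
  assumes "distinct [a, b, x, c, d]"
  shows "card (layer_new a b x c d) = 18"
proof -
  have V: "{a, x, c} \<noteq> {b, x, d}" "{a, x, c} \<noteq> {b, x, c}" "{a, x, c} \<noteq> {a, b, c}"
    "{a, x, c} \<noteq> {a, b}" "{b, x, d} \<noteq> {b, x, c}" "{b, x, d} \<noteq> {a, b, c}" "{b, x, d} \<noteq> {a, b}"
    "{b, x, c} \<noteq> {a, b, c}" "{b, x, c} \<noteq> {a, b}" "{a, b, c} \<noteq> {a, b}"
    using assms by (simp_all add: set_eq_subset) metis+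
  have "odd3 a x c \<inter> odd3 b x d = {}" "odd3 a x c \<inter> ev3 b x c = {}"
    "odd3 a x c \<inter> ev2_weak a b c = {}" "odd3 a x c \<inter> ev2 a b = {}"
    "odd3 b x d \<inter> ev3 b x c = {}" "odd3 b x d \<inter> ev2_weak a b c = {}"
    "odd3 b x d \<inter> ev2 a b = {}" "ev3 b x c \<inter> ev2_weak a b c = {}"
    "ev3 b x c \<inter> ev2 a b = {}" "ev2_weak a b c \<inter> ev2 a b = {}"
    by (rule disjoint_if_vars; (erule vars_parity | rule V))+
  then show ?thesis
    using assms unfolding layer_new_def by (simp add: card_Un_disjoint card_parity Int_Un_distrib2)
qed

text \<open>The count is 4 + 4 + 4 + 2 + 2 + 3. Families over the same variables are separated by
  parity, and the last three clauses by the absence of \<open>q\<close>.\<close>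

lemma card_final_new:
  assumes "distinct [p, q, c, d]"
  shows "card (final_new p q c d) = 19"
proof -
  let ?W = "odd3 p q c \<union> odd3 p q d \<union> ev3 p q c \<union> ev2 p q \<union> odd2 p q"
  let ?U = "{{Pos p}, {Neg p}, {}}"
  have assms': "distinct [p, q, c]" "p \<noteq> q" using assms by simp_all
  have V: "{p, q, c} \<noteq> {p, q, d}" "{p, q, d} \<noteq> {p, q, c}" "{p, q, c} \<noteq> {p, q}"
    "{p, q, d} \<noteq> {p, q}"
    using assms by (simp_all add: set_eq_subset) metis+
  have "odd3 p q c \<inter> odd3 p q d = {}" "odd3 p q d \<inter> ev3 p q c = {}"
    "odd3 p q c \<inter> ev2 p q = {}" "odd3 p q d \<inter> ev2 p q = {}" "ev3 p q c \<inter> ev2 p q = {}"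
    "odd3 p q c \<inter> odd2 p q = {}" "odd3 p q d \<inter> odd2 p q = {}" "ev3 p q c \<inter> odd2 p q = {}"
    by (rule disjoint_if_vars; (erule vars_parity | rule V))+
  moreover have "odd3 p q c \<inter> ev3 p q c = {}"
    using odd_neg_parity(3,4)[OF assms'(1)] by blast
  moreover have "ev2 p q \<inter> odd2 p q = {}"
    using odd_neg_parity(1,2)[OF assms'(2)] by blast
  ultimately have "card ?W = 16"
    using assms by (simp add: card_Un_disjoint card_parity Int_Un_distrib2)
  moreover have "card ?U = 3" by simp
  moreover have "?W \<inter> ?U = {}"
  proof -
    have "q \<in> vars_clause C" if "C \<in> ?W" for C
      using that by (elim UnE) (simp_all add: vars_parity)
    moreover have "q \<notin> vars_clause C" if "C \<in> ?U" for C
      using that assms'(2) by auto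
    ultimately show ?thesis by blast
  qed
  then have "card (?W \<union> ?U) = card ?W + card ?U"
    by (intro card_Un_disjoint finite_UnI finite_parity finite.insertI finite.emptyI)
  ultimately show ?thesis
    unfolding final_new_def by (simp only:)
qed

subsection \<open>The translation for \<open>n \<ge> 3\<close>\<close>

locale T_vars =
  fixes v y y' :: "nat \<Rightarrow> 'v" and n :: nat
  assumes n3: "n \<ge> 3"
    and inj_v: "inj_on v {1..n}" and inj_y: "inj_on y {2..n - 1}" and inj_y': "inj_on y' {2..n - 1}"
    and v_y: "v ` {1..n} \<inter> y ` {2..n - 1} = {}"
    and v_y': "v ` {1..n} \<inter> y' ` {2..n - 1} = {}"
    and y_y': "y ` {2..n - 1} \<inter> y' ` {2..n - 1} = {}"
begin

declare One_nat_def [simp del]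

section \<open>Distinctness of the variables and grouping of the clauses into layers\<close>

lemma v_eq: "1 \<le> i \<Longrightarrow> i \<le> n \<Longrightarrow> 1 \<le> j \<Longrightarrow> j \<le> n \<Longrightarrow> v i = v j \<longleftrightarrow> i = j"
  using inj_on_eq_iff[OF inj_v] by simp

lemma y_eq: "2 \<le> i \<Longrightarrow> i < n \<Longrightarrow> 2 \<le> j \<Longrightarrow> j < n \<Longrightarrow> y i = y j \<longleftrightarrow> i = j"
  using inj_on_eq_iff[OF inj_y] by simp

lemma y'_eq: "2 \<le> i \<Longrightarrow> i < n \<Longrightarrow> 2 \<le> j \<Longrightarrow> j < n \<Longrightarrow> y' i = y' j \<longleftrightarrow> i = j"
  using inj_on_eq_iff[OF inj_y'] by simp

lemma v_ne_y:
  assumes "1 \<le> i" "i \<le> n" "2 \<le> j" "j < n"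
  shows "v i \<noteq> y j" "y j \<noteq> v i" "v i \<noteq> y' j" "y' j \<noteq> v i"
proof -
  have "v i \<in> v ` {1..n}" "y j \<in> y ` {2..n - 1}" "y' j \<in> y' ` {2..n - 1}"
    using assms by simp_all
  then have "v i \<noteq> y j" "v i \<noteq> y' j"
    using v_y v_y' unfolding disjoint_iff by metis+
  then show "v i \<noteq> y j" "y j \<noteq> v i" "v i \<noteq> y' j" "y' j \<noteq> v i" by simp_all
qed

lemma y_ne_y':
  assumes "2 \<le> i" "i < n" "2 \<le> j" "j < n"
  shows "y i \<noteq> y' j" "y' j \<noteq> y i"
proof -
  have "y i \<in> y ` {2..n - 1}" "y' j \<in> y' ` {2..n - 1}"
    using assms by simp_all
  then have "y i \<noteq> y' j"
    using y_y' unfolding disjoint_iff by metis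
  then show "y i \<noteq> y' j" "y' j \<noteq> y i" by simp_all
qed

lemmas var_ne = v_eq y_eq y'_eq v_ne_y y_ne_y'

text \<open>Every clause of \<open>layer i\<close> contains \<open>v i\<close> and no other \<open>v j\<close> with \<open>j \<ge> 2\<close>, which makes
  the layers disjoint.\<close>

definition layer :: "nat \<Rightarrow> 'v clause_set" where
  "layer i =
    (if i = 2 then odd3 (v 1) (v 2) (y 2) \<union> odd3 (v 1) (v 2) (y' 2)
     else if i < n then odd3 (y (i - 1)) (v i) (y i) \<union> odd3 (y' (i - 1)) (v i) (y' i)
     else odd2 (y (n - 1)) (v n) \<union> ev2 (y' (n - 1)) (v n))"

lemma layer_2: "layer 2 = odd3 (v 1) (v 2) (y 2) \<union> odd3 (v 1) (v 2) (y' 2)"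
  and layer_mid: "3 \<le> i \<Longrightarrow> i < n \<Longrightarrow>
    layer i = odd3 (y (i - 1)) (v i) (y i) \<union> odd3 (y' (i - 1)) (v i) (y' i)"
  and layer_n: "layer n = odd2 (y (n - 1)) (v n) \<union> ev2 (y' (n - 1)) (v n)"
  using n3 by (simp_all add: layer_def)

lemma layer_cases:
  assumes "2 \<le> i" "i \<le> n"
  obtains "i = 2" | "3 \<le> i" "i < n" | "i = n"
proof -
  have "i = 2 \<or> 3 \<le> i \<and> i < n \<or> i = n" using assms by linarith
  then show thesis using that by blast
qed

lemma index_split: "{2..n} = insert 2 ({3..n - 1} \<union> {n})"
  using n3 by auto

text \<open>\<open>T\<close> lists one chain after the other; here the chains are interleaved by
  index, so that the pieces suit both the counting and the steps of the refutation.\<close>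

lemma T_eq: "T v y y' n = (\<Union>i\<in>{2..n}. layer i)"
proof -
  have X: "X0 {Pos (v 1), Pos (v 2), Pos (y 2)} = odd3 (v 1) (v 2) (y 2)"
    "X0 {Pos (v 1), Pos (v 2), Pos (y' 2)} = odd3 (v 1) (v 2) (y' 2)"
    "X0 {Pos (y (n - 1)), Pos (v n)} = odd2 (y (n - 1)) (v n)"
    "X0 {Pos (y' (n - 1)), Neg (v n)} = ev2 (y' (n - 1)) (v n)"
    using n3 by (simp_all add: X0_2 X0_3 var_ne)
  have Xi: "X0 {Pos (y (i - 1)), Pos (v i), Pos (y i)} \<union> X0 {Pos (y' (i - 1)), Pos (v i), Pos (y' i)}
      = layer i" if "3 \<le> i" "i \<le> n - 1" for i
    using that by (subst (1 2) X0_3) (simp_all add: var_ne layer_mid)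
  have "T v y y' n = (odd3 (v 1) (v 2) (y 2) \<union> odd3 (v 1) (v 2) (y' 2)) \<union>
     (\<Union>i\<in>{3..n - 1}. X0 {Pos (y (i - 1)), Pos (v i), Pos (y i)} \<union>
        X0 {Pos (y' (i - 1)), Pos (v i), Pos (y' i)}) \<union>
     (odd2 (y (n - 1)) (v n) \<union> ev2 (y' (n - 1)) (v n))"
  proof -
    have f: "{f i | i. 3 \<le> i \<and> i \<le> n - 1} = f ` {3..n - 1}" for f :: "nat \<Rightarrow> 'v clause"
      by auto
    have "\<not> n \<le> 2" using n3 by simp
    then show ?thesis
      unfolding T_def f X[symmetric] by (simp add: UN_Un UN_Un_distrib) blast
  qed
  also have "\<dots> = layer 2 \<union> (\<Union>i\<in>{3..n - 1}. layer i) \<union> layer n"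
    using Xi unfolding layer_2 layer_n by auto
  also have "\<dots> = (\<Union>i\<in>{2..n}. layer i)"
    unfolding index_split by auto
  finally show ?thesis .
qed

lemma layer_subset: "2 \<le> i \<Longrightarrow> i \<le> n \<Longrightarrow> layer i \<subseteq> T v y y' n"
  unfolding T_eq by (rule UN_upper) simp

lemma layer_var:
  assumes "2 \<le> i" "i \<le> n" "2 \<le> j" "j \<le> n" "C \<in> layer i"
  shows "v j \<in> vars_clause C \<longleftrightarrow> j = i"
  using assms(1,2)
proof (cases rule: layer_cases)
  case 1
  with assms n3 show ?thesis by (auto simp: layer_2 var_ne dest!: vars_parity)
next
  case 2
  with assms n3 show ?thesis by (auto simp: layer_mid var_ne dest!: vars_parity)
next
  case 3
  with assms n3 show ?thesis by (auto simp: layer_n var_ne dest!: vars_parity)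
qed

section \<open>Counting clauses, literal occurrences and variables\<close>

lemma disjoint_layers:
  "\<forall>i\<in>{2..n}. \<forall>j\<in>{2..n}. i \<noteq> j \<longrightarrow> layer i \<inter> layer j = {}"
  using layer_var by (metis atLeastAtMost_iff disjoint_iff)

lemma finite_layer: "finite (layer i)"
  by (simp add: layer_def)

text \<open>In each layer some unprimed \<open>y\<close> variable occurs in the first constraint but
  not in the second.\<close>

lemma layer_disjoint_parts:
  "odd3 (v 1) (v 2) (y 2) \<inter> odd3 (v 1) (v 2) (y' 2) = {}"
  "3 \<le> i \<Longrightarrow> i < n \<Longrightarrow> odd3 (y (i - 1)) (v i) (y i) \<inter> odd3 (y' (i - 1)) (v i) (y' i) = {}"
  "odd2 (y (n - 1)) (v n) \<inter> ev2 (y' (n - 1)) (v n) = {}"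
proof -
  have "y 2 \<notin> {v 1, v 2, y' 2}" using n3 by (simp add: var_ne)
  then show "odd3 (v 1) (v 2) (y 2) \<inter> odd3 (v 1) (v 2) (y' 2) = {}"
    by (intro disjoint_if_vars[OF vars_parity(3) vars_parity(3)]) auto
next
  assume "3 \<le> i" "i < n"
  then have "y i \<notin> {y' (i - 1), v i, y' i}" by (simp add: var_ne)
  then show "odd3 (y (i - 1)) (v i) (y i) \<inter> odd3 (y' (i - 1)) (v i) (y' i) = {}"
    by (intro disjoint_if_vars[OF vars_parity(3) vars_parity(3)]) auto
next
  have "y (n - 1) \<notin> {y' (n - 1), v n}" using n3 by (simp add: var_ne)
  then show "odd2 (y (n - 1)) (v n) \<inter> ev2 (y' (n - 1)) (v n) = {}"
    by (intro disjoint_if_vars[OF vars_parity(1) vars_parity(2)]) auto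
qed

lemma card_layer:
  assumes "2 \<le> i" "i \<le> n"
  shows "card (layer i) = (if i < n then 8 else 4)"
  using assms
proof (cases rule: layer_cases)
  case 1
  with n3 show ?thesis
    unfolding 1 layer_2 by (simp add: card_Un_disjoint layer_disjoint_parts card_parity var_ne)
next
  case 2
  with n3 show ?thesis
    by (simp add: layer_mid card_Un_disjoint layer_disjoint_parts card_parity var_ne)
next
  case 3
  with n3 show ?thesis
    unfolding 3 layer_n by (simp add: card_Un_disjoint layer_disjoint_parts card_parity var_ne)
qed

lemma card_clause_layer:
  assumes "2 \<le> i" "i \<le> n" "C \<in> layer i"
  shows "card C = (if i < n then 3 else 2)"
  using assms(1,2)
proof (cases rule: layer_cases)
  case 1
  with assms n3 show ?thesis by (auto simp: layer_2 card_clause_parity var_ne)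
next
  case 2
  with assms n3 show ?thesis by (auto simp: layer_mid card_clause_parity var_ne)
next
  case 3
  with assms n3 show ?thesis by (auto simp: layer_n card_clause_parity var_ne)
qed

text \<open>Only the last layer is binary, so the totals have the form
  \<open>8 * (n - 2) + 4\<close> for clauses and \<open>24 * (n - 2) + 8\<close> for literal
  occurrences.\<close>

lemma sum_index: "(\<Sum>i\<in>{2..n}. if i < n then a else b) = (n - 2) * a + (b :: nat)"
proof -
  have "{2..n} = insert n {2..<n}" using n3 by auto
  then show ?thesis by simp
qed

lemma num_clauses_T: "num_clauses (T v y y' n) = 8 * n - 12"
proof -
  have "card (T v y y' n) = (\<Sum>i\<in>{2..n}. card (layer i))"
    unfolding T_eq by (rule card_UN_disjoint[OF _ _ disjoint_layers]) (simp_all add: finite_layer)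
  also have "\<dots> = (\<Sum>i\<in>{2..n}. if i < n then 8 else 4)"
    by (intro sum.cong) (simp_all add: card_layer)
  finally show ?thesis using n3 unfolding num_clauses_def sum_index by linarith
qed

lemma num_lit_occs_T: "num_lit_occs (T v y y' n) = 24 * n - 40"
proof -
  have "(\<Sum>C\<in>T v y y' n. card C) = (\<Sum>i\<in>{2..n}. \<Sum>C\<in>layer i. card C)"
    unfolding T_eq by (rule sum.UNION_disjoint[OF _ _ disjoint_layers]) (simp_all add: finite_layer)
  also have "\<dots> = (\<Sum>i\<in>{2..n}. if i < n then 24 else 8)"
  proof (intro sum.cong refl)
    fix i assume i: "i \<in> {2..n}"
    have "(\<Sum>C\<in>layer i. card C) = (\<Sum>C\<in>layer i. if i < n then 3 else 2)"
      using i by (intro sum.cong) (simp_all add: card_clause_layer)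
    then show "(\<Sum>C\<in>layer i. card C) = (if i < n then 24 else 8)"
      using i by (simp add: card_layer)
  qed
  finally show ?thesis using n3 unfolding num_lit_occs_def sum_index by linarith
qed

lemma vars_odd3: "\<Union> (vars_clause ` odd3 a b c) = {a, b, c}"
  and vars_odd2: "\<Union> (vars_clause ` odd2 a b) = {a, b}"
  and vars_ev2: "\<Union> (vars_clause ` ev2 a b) = {a, b}"
  by (simp_all add: parity_defs)

lemma vars_T: "(\<Union>C\<in>T v y y' n. vars_clause C) = v ` {1..n} \<union> y ` {2..n - 1} \<union> y' ` {2..n - 1}"
proof -
  define W where "W = v ` {1..n} \<union> y ` {2..n - 1} \<union> y' ` {2..n - 1}"
  define U where "U = (\<Union>C\<in>T v y y' n. vars_clause C)"
  have v: "v i \<in> W" if "1 \<le> i" "i \<le> n" for i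
    using that unfolding W_def by simp
  have y: "y i \<in> W" "y' i \<in> W" if "2 \<le> i" "i < n" for i
    using that unfolding W_def by simp_all
  have U_layer: "\<Union> (vars_clause ` layer i) \<subseteq> U" if "2 \<le> i" "i \<le> n" for i
    using that unfolding U_def T_eq by auto
  have vars_2: "\<Union> (vars_clause ` layer 2) = {v 1, v 2, y 2} \<union> {v 1, v 2, y' 2}"
    unfolding layer_2 image_Un Union_Un_distrib vars_odd3 ..
  have vars_mid: "\<Union> (vars_clause ` layer i) = {y (i - 1), v i, y i} \<union> {y' (i - 1), v i, y' i}"
    if "3 \<le> i" "i < n" for i
    unfolding layer_mid[OF that] image_Un Union_Un_distrib vars_odd3 ..
  have vars_n: "\<Union> (vars_clause ` layer n) = {y (n - 1), v n} \<union> {y' (n - 1), v n}"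
    unfolding layer_n image_Un Union_Un_distrib vars_odd2 vars_ev2 ..
  have "\<Union> (vars_clause ` layer i) \<subseteq> W" if "2 \<le> i" "i \<le> n" for i
    using that
  proof (cases rule: layer_cases)
    case 1
    show ?thesis unfolding 1 vars_2 using n3 by (simp add: v y)
  next
    case 2
    show ?thesis unfolding vars_mid[OF 2] using 2 by (simp add: v y)
  next
    case 3
    show ?thesis unfolding 3 vars_n using n3 by (simp add: v y)
  qed
  then have "U \<subseteq> W" unfolding U_def T_eq by fastforce
  \<comment> \<open>Layer \<open>i\<close> supplies all three variables of index
    \<open>i < n\<close>; the remaining \<open>v 1\<close> and \<open>v n\<close> come from the
    first and the last layer.\<close>
  have *: "v i \<in> U" "y i \<in> U" "y' i \<in> U" if "2 \<le> i" "i < n" for i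
  proof -
    have "{v i, y i, y' i} \<subseteq> U"
    proof (cases "i = 2")
      case True
      show ?thesis using U_layer[of 2] n3 unfolding True vars_2 by simp
    next
      case False
      then show ?thesis using U_layer[of i] vars_mid[of i] that by simp
    qed
    then show "v i \<in> U" "y i \<in> U" "y' i \<in> U" by simp_all
  qed
  moreover have "v 1 \<in> U" "v n \<in> U"
    using U_layer[of 2] U_layer[of n] n3 unfolding vars_2 vars_n by simp_all
  ultimately have "v i \<in> U" if "1 \<le> i" "i \<le> n" for i
    using that by (metis One_nat_def Suc_1 Suc_leI le_neq_implies_less)
  then have "W \<subseteq> U"
    unfolding W_def using *(2,3) n3 by (intro Un_least image_subsetI) auto
  with \<open>U \<subseteq> W\<close> show ?thesis unfolding U_def W_def by blast
qed

lemma num_vars_T: "num_vars (T v y y' n) = 3 * n - 4"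
proof -
  have "card (v ` {1..n} \<union> y ` {2..n - 1} \<union> y' ` {2..n - 1}) = n + (n - 2) + (n - 2)"
    using inj_v inj_y inj_y' v_y v_y' y_y'
    by (subst card_Un_disjoint; simp add: card_image Int_Un_distrib2)+
  then show ?thesis using n3 unfolding num_vars_def vars_T by linarith
qed

lemma card_clause_T: "C \<in> T v y y' n \<Longrightarrow> card C \<le> 3"
  unfolding T_eq by (auto simp: card_clause_layer)

section \<open>Lower bound for the width\<close>

text \<open>The binary clauses of \<open>T\<close> express \<open>y (n - 1) = v n\<close> and \<open>y' (n - 1) \<noteq> v n\<close>;
  \<open>subst_lit\<close> solves them for the auxiliary variables.\<close>

definition subst_lit :: "'v literal \<Rightarrow> 'v literal" where
  "subst_lit l = (if var_lit l = y (n - 1) then map_literal (\<lambda>_. v n) l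
    else if var_lit l = y' (n - 1) then compl_lit (map_literal (\<lambda>_. v n) l) else l)"

lemma subst_lit_compl: "subst_lit (compl_lit l) = compl_lit (subst_lit l)"
  by (cases l) (auto simp: subst_lit_def)

lemma var_subst_lit:
  "var_lit (subst_lit l) = (if var_lit l \<in> {y (n - 1), y' (n - 1)} then v n else var_lit l)"
  by (cases l) (auto simp: subst_lit_def)

text \<open>Passing to variables can only shrink the image, so three variables force three literals.
  This spares a case split over signs.\<close>

lemma blocked_subst_lit_if_card:
  assumes "finite C" "card (var_lit ` subst_lit ` C) = 3"
  shows "blocked (subst_lit ` C)"
  using card_image_le[of "subst_lit ` C" var_lit] assms unfolding blocked_def by simp

text \<open>Binary clauses become complementary pairs. A ternary clause contains neither
  \<open>v n\<close> nor both of \<open>y (n - 1)\<close> and \<open>y' (n - 1)\<close>, so the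
  substitution keeps its three variables distinct.\<close>

lemma blocked_layer:
  assumes "2 \<le> i" "i \<le> n" "C \<in> layer i"
  shows "blocked (subst_lit ` C)"
proof (cases "i = n")
  case True
  then have "C \<in> odd2 (y (n - 1)) (v n) \<or> C \<in> ev2 (y' (n - 1)) (v n)"
    using assms(3) layer_n by auto
  moreover have "v n \<noteq> y (n - 1)" "v n \<noteq> y' (n - 1)" "y' (n - 1) \<noteq> y (n - 1)"
    using n3 by (simp_all add: var_ne)
  ultimately show ?thesis by (auto simp: parity_defs subst_lit_def blocked_def)
next
  case False
  define f where "f x = (if x \<in> {y (n - 1), y' (n - 1)} then v n else x)" for x
  have "var_lit ` subst_lit ` C = f ` vars_clause C"
    unfolding vars_clause_def image_image f_def var_subst_lit ..
  moreover have "card (f ` vars_clause C) = 3"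
  proof (cases "i = 2")
    case True
    then have "vars_clause C = {v 1, v 2, y 2} \<or> vars_clause C = {v 1, v 2, y' 2}"
      using assms(3) layer_2 vars_parity(3) by (metis Un_iff)
    \<comment> \<open>\<open>y 2\<close> and \<open>y' 2\<close> are substituted exactly when
      \<open>n = 3\<close>; membership in a pair covers both cases.\<close>
    moreover have "f (v 1) = v 1" "f (v 2) = v 2" "f (y 2) \<in> {y 2, v n}" "f (y' 2) \<in> {y' 2, v n}"
      using n3 by (simp_all add: f_def var_ne)
    ultimately show ?thesis using n3 by (auto simp: var_ne)
  next
    case i2: False
    with assms False have i: "3 \<le> i" "i < n" by auto
    then have "vars_clause C = {y (i - 1), v i, y i} \<or> vars_clause C = {y' (i - 1), v i, y' i}"
      using assms(3) layer_mid vars_parity(3) by (metis Un_iff)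
    moreover have "f (y (i - 1)) = y (i - 1)" "f (y' (i - 1)) = y' (i - 1)" "f (v i) = v i"
      "f (y i) \<in> {y i, v n}" "f (y' i) \<in> {y' i, v n}"
      using i by (simp_all add: f_def var_ne)
    ultimately show ?thesis using i by (auto simp: var_ne)
  qed
  moreover have "finite C"
    using card_clause_layer[OF assms] by (metis card.infinite zero_neq_numeral)
  ultimately show ?thesis using blocked_subst_lit_if_card by metis
qed

lemma whd_lower:
  assumes "refutation (T v y y' n) t" "parent_bounded k t"
  shows "3 \<le> k"
proof (rule ccontr)
  assume "\<not> 3 \<le> k"
  then have "parent_bounded 2 t" using assms(2) parent_bounded_mono by fastforce
  moreover have "blocked (subst_lit ` C)" if "C \<in> T v y y' n" for C
    using that blocked_layer unfolding T_eq by auto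
  ultimately have "blocked (subst_lit ` concl t)"
    using parent_bounded_2_blocked[of subst_lit, OF subst_lit_compl] assms(1)
    unfolding refutation_def by blast
  then show False using assms(1) by (simp add: refutation_def blocked_def)
qed

section \<open>A refutation with \<open>18 * n - 29\<close> clauses\<close>

lemma start_trees:
  obtains s1 s2 where
    "resolution_tree (T v y y' n) s1" "concl s1 = {Pos (y (n - 1)), Pos (y' (n - 1))}"
    "resolution_tree (T v y y' n) s2" "concl s2 = {Neg (y (n - 1)), Neg (y' (n - 1))}"
    "labels s1 \<union> labels s2 = layer n \<union> ev2 (y (n - 1)) (y' (n - 1))"
proof
  \<comment> \<open>Eliminating \<open>?c\<close> from \<open>?a = ?c\<close> and
    \<open>?b \<noteq> ?c\<close> gives \<open>?a \<noteq> ?b\<close>.\<close>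
  let ?a = "y (n - 1)" and ?b = "y' (n - 1)" and ?c = "v n"
  let ?s1 = "Resolve {Pos ?a, Pos ?b} (Leaf {Pos ?a, Neg ?c}) (Leaf {Pos ?b, Pos ?c})"
  let ?s2 = "Resolve {Neg ?a, Neg ?b} (Leaf {Neg ?a, Pos ?c}) (Leaf {Neg ?b, Neg ?c})"
  have "distinct [?a, ?b, ?c]" using n3 by (simp add: var_ne)
  have "layer n \<subseteq> T v y y' n" using n3 by (intro layer_subset) simp_all
  then have F: "{Pos ?a, Neg ?c} \<in> T v y y' n" "{Pos ?b, Pos ?c} \<in> T v y y' n"
    "{Neg ?a, Pos ?c} \<in> T v y y' n" "{Neg ?b, Neg ?c} \<in> T v y y' n"
    unfolding layer_n parity_defs by simp_all
  have "is_resolvent {Pos ?a, Neg ?c} {Pos ?b, Pos ?c} {Pos ?a, Pos ?b}"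
    by (rule is_resolventI[where x = "Neg ?c"]) (use \<open>distinct [?a, ?b, ?c]\<close> in auto)
  then show "resolution_tree (T v y y' n) ?s1" using F by simp
  have "is_resolvent {Neg ?a, Pos ?c} {Neg ?b, Neg ?c} {Neg ?a, Neg ?b}"
    by (rule is_resolventI[where x = "Pos ?c"]) (use \<open>distinct [?a, ?b, ?c]\<close> in auto)
  then show "resolution_tree (T v y y' n) ?s2" using F by simp
  show "labels ?s1 \<union> labels ?s2 = layer n \<union> ev2 ?a ?b"
    unfolding layer_n parity_defs by (intro set_eqI, simp only: label_mem_simps) argo
qed simp_all

text \<open>Bounds the variables met down to level \<open>k\<close>. It leaves out the
  \<open>y\<close> and \<open>y'\<close> variables of lower index, which makes the clauses of the
  next step new.\<close>

definition upper_vars :: "nat \<Rightarrow> 'v set" where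
  "upper_vars k = v ` {Suc k..n} \<union> y ` {k..n - 1} \<union> y' ` {k..n - 1}"

text \<open>The count splits as 4 axioms and 2 resolvents for \<open>k = n - 1\<close>, and 8 axioms and
  10 resolvents for every further level.\<close>

definition derives_difference ::
  "nat \<Rightarrow> 'v clause res_tree \<Rightarrow> 'v clause res_tree \<Rightarrow> bool" where
  "derives_difference k s1 s2 \<longleftrightarrow>
    (resolution_tree (T v y y' n) s1 \<and> concl s1 = {Pos (y k), Pos (y' k)}) \<and>
    (resolution_tree (T v y y' n) s2 \<and> concl s2 = {Neg (y k), Neg (y' k)}) \<and>
    card (labels s1 \<union> labels s2) = 6 + 18 * (n - 1 - k) \<and>
    (\<forall>C\<in>labels s1 \<union> labels s2. card C \<in> {2, 3} \<and> vars_clause C \<subseteq> upper_vars k)"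

lemma derives_difference_last: "\<exists>s1 s2. derives_difference (n - 1) s1 s2"
proof -
  obtain s1 s2 where s:
    "resolution_tree (T v y y' n) s1" "concl s1 = {Pos (y (n - 1)), Pos (y' (n - 1))}"
    "resolution_tree (T v y y' n) s2" "concl s2 = {Neg (y (n - 1)), Neg (y' (n - 1))}"
    "labels s1 \<union> labels s2 = layer n \<union> ev2 (y (n - 1)) (y' (n - 1))"
    by (rule start_trees)
  let ?E = "ev2 (y (n - 1)) (y' (n - 1))"
  have ne: "y (n - 1) \<noteq> y' (n - 1)" using n3 by (simp add: var_ne)
  have "v n \<notin> vars_clause C" if "C \<in> ?E" for C
    using vars_parity(2)[OF that] n3 by (simp add: var_ne)
  moreover have "v n \<in> vars_clause C" if "C \<in> layer n" for C
    using layer_var[OF _ _ _ _ that] n3 by simp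
  ultimately have "layer n \<inter> ?E = {}" by blast
  then have "card (layer n \<union> ?E) = 6"
    using n3 by (simp add: card_Un_disjoint finite_layer card_layer card_parity var_ne)
  moreover have "card C \<in> {2, 3} \<and> vars_clause C \<subseteq> upper_vars (n - 1)"
    if "C \<in> layer n \<union> ?E" for C
  proof
    show "card C \<in> {2, 3}"
      using that
    proof
      assume "C \<in> layer n"
      then show ?thesis using card_clause_layer[of n C] n3 by simp
    next
      assume "C \<in> ?E"
      then show ?thesis using ne by (simp add: card_clause_parity)
    qed
    have "{y (n - 1), y' (n - 1), v n} \<subseteq> upper_vars (n - 1)"
      using n3 unfolding upper_vars_def by simp
    then show "vars_clause C \<subseteq> upper_vars (n - 1)"
      using that unfolding layer_n by (elim UnE) (simp_all add: vars_parity)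
  qed
  ultimately have "derives_difference (n - 1) s1 s2"
    unfolding derives_difference_def s(5) using s(1-4) by simp
  then show ?thesis by blast
qed

text \<open>Every clause of \<open>layer_new\<close> contains \<open>y k\<close> or
  \<open>y' k\<close>, and neither lies in \<open>upper_vars (Suc k)\<close>; hence exactly 18
  clauses are added.\<close>

lemma derives_difference_step:
  assumes k: "2 \<le> k" "k < n - 1" and "derives_difference (Suc k) s1 s2"
  shows "\<exists>t1 t2. derives_difference k t1 t2"
proof -
  have s: "resolution_tree (T v y y' n) s1" "concl s1 = {Pos (y (Suc k)), Pos (y' (Suc k))}"
    "resolution_tree (T v y y' n) s2" "concl s2 = {Neg (y (Suc k)), Neg (y' (Suc k))}"
    "card (labels s1 \<union> labels s2) = 6 + 18 * (n - 1 - Suc k)"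
    and lab: "\<And>C. C \<in> labels s1 \<union> labels s2 \<Longrightarrow>
      card C \<in> {2, 3} \<and> vars_clause C \<subseteq> upper_vars (Suc k)"
    using assms(3) unfolding derives_difference_def by blast+
  let ?N = "layer_new (y k) (y' k) (v (Suc k)) (y (Suc k)) (y' (Suc k))"
  have d: "distinct [y k, y' k, v (Suc k), y (Suc k), y' (Suc k)]"
    using k by (simp add: var_ne)
  have "layer (Suc k) \<subseteq> T v y y' n" using k by (intro layer_subset) simp_all
  then have F: "odd3 (y k) (v (Suc k)) (y (Suc k)) \<subseteq> T v y y' n"
    "odd3 (y' k) (v (Suc k)) (y' (Suc k)) \<subseteq> T v y y' n"
    using k layer_mid[of "Suc k"] by simp_all
  obtain t1 t2 where t: "resolution_tree (T v y y' n) t1" "concl t1 = {Pos (y k), Pos (y' k)}"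
    "resolution_tree (T v y y' n) t2" "concl t2 = {Neg (y k), Neg (y' k)}"
    "labels t1 \<union> labels t2 = labels s1 \<union> labels s2 \<union> ?N"
    by (rule layer_trees[OF d F s(1-4)])
  have "y k \<notin> upper_vars (Suc k)" "y' k \<notin> upper_vars (Suc k)"
    using k by (auto simp: upper_vars_def var_ne)
  moreover have "y k \<in> vars_clause C \<or> y' k \<in> vars_clause C" if "C \<in> ?N" for C
    using that unfolding layer_new_def by (elim UnE) (simp_all add: vars_parity)
  ultimately have "(labels s1 \<union> labels s2) \<inter> ?N = {}" using lab by blast
  then have "card (labels s1 \<union> labels s2 \<union> ?N) = card (labels s1 \<union> labels s2) + card ?N"
    by (intro card_Un_disjoint) (simp_all add: layer_new_def)
  \<comment> \<open>By \<open>k < n - 1\<close>, the truncated difference \<open>n - 1 - k\<close>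
    is one more than \<open>n - 1 - Suc k\<close>.\<close>
  then have "card (labels s1 \<union> labels s2 \<union> ?N) = 6 + 18 * (n - 1 - k)"
    using s(5) card_layer_new[OF d] k by simp
  moreover have "upper_vars (Suc k) \<subseteq> upper_vars k"
    unfolding upper_vars_def by (intro Un_mono image_mono) simp_all
  then have "card C \<in> {2, 3} \<and> vars_clause C \<subseteq> upper_vars k" if "C \<in> labels s1 \<union> labels s2" for C
    using lab[OF that] by blast
  moreover have "card C \<in> {2, 3} \<and> vars_clause C \<subseteq> upper_vars k" if "C \<in> ?N" for C
  proof
    show "card C \<in> {2, 3}"
      using that d unfolding layer_new_def by (elim UnE) (simp_all add: card_clause_parity)
    have "{y k, y' k, v (Suc k), y (Suc k), y' (Suc k)} \<subseteq> upper_vars k"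
      using k unfolding upper_vars_def by simp
    then show "vars_clause C \<subseteq> upper_vars k"
      using that unfolding layer_new_def by (elim UnE) (simp_all add: vars_parity)
  qed
  ultimately have "derives_difference k t1 t2"
    unfolding derives_difference_def t(5) using t(1-4) by blast
  then show ?thesis by blast
qed

lemma ex_derives_difference:
  assumes "2 \<le> k" "k \<le> n - 1"
  shows "\<exists>s1 s2. derives_difference k s1 s2"
  \<comment> \<open>The upper bound on \<open>k\<close> feeds the downward induction from
    \<open>n - 1\<close>, while \<open>2 \<le> k\<close> stays a premise of the induction
    claim.\<close>
  using assms(2,1)
proof (induction k rule: inc_induct)
  case base
  show ?case by (rule derives_difference_last)
next
  case (step k)
  have "2 \<le> Suc k" using step.prems by simp
  then obtain s1 s2 where "derives_difference (Suc k) s1 s2"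
    using step.IH by blast
  then show ?case
    using derives_difference_step step.prems step.hyps by blast
qed

text \<open>The total is \<open>6 + 18 * (n - 3) + 19\<close>. The final clauses are new because
  each contains \<open>v 1\<close> or is empty.\<close>

lemma refutation_T:
  obtains t where "refutation (T v y y' n) t" "card (labels t) = 18 * n - 29"
    "\<forall>C\<in>labels t. card C \<le> 3"
proof -
  have "2 \<le> n - 1" using n3 by simp
  then obtain s1 s2 where D: "derives_difference 2 s1 s2"
    using ex_derives_difference[OF order_refl] by blast
  have s: "resolution_tree (T v y y' n) s1" "concl s1 = {Pos (y 2), Pos (y' 2)}"
    "resolution_tree (T v y y' n) s2" "concl s2 = {Neg (y 2), Neg (y' 2)}"
    "card (labels s1 \<union> labels s2) = 6 + 18 * (n - 1 - 2)"
    and lab: "\<And>C. C \<in> labels s1 \<union> labels s2 \<Longrightarrow>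
      card C \<in> {2, 3} \<and> vars_clause C \<subseteq> upper_vars 2"
    using D unfolding derives_difference_def by blast+
  have d: "distinct [v 1, v 2, y 2, y' 2]" using n3 by (simp add: var_ne)
  have "layer 2 \<subseteq> T v y y' n" using n3 by (intro layer_subset) simp_all
  then have F: "odd3 (v 1) (v 2) (y 2) \<subseteq> T v y y' n" "odd3 (v 1) (v 2) (y' 2) \<subseteq> T v y y' n"
    unfolding layer_2 by simp_all
  let ?N = "final_new (v 1) (v 2) (y 2) (y' 2)"
  obtain t where t: "refutation (T v y y' n) t" "labels t = labels s1 \<union> labels s2 \<union> ?N"
    by (rule final_tree[OF d F s(1-4)])
  have "v 1 \<notin> upper_vars 2"
    using n3 by (auto simp: upper_vars_def var_ne)
  moreover have "v 1 \<in> vars_clause C \<or> C = {}" if "C \<in> ?N" for C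
    using that unfolding final_new_def by (elim UnE) (auto simp: vars_parity)
  \<comment> \<open>Here the lower bound 2 on clause lengths in \<open>derives_difference\<close>
    excludes the empty clause.\<close>
  moreover have "C \<noteq> {}" if "C \<in> labels s1 \<union> labels s2" for C
    using lab[OF that] by auto
  ultimately have "(labels s1 \<union> labels s2) \<inter> ?N = {}" using lab by blast
  then have "card (labels t) = card (labels s1 \<union> labels s2) + card ?N"
    unfolding t(2) by (intro card_Un_disjoint) (simp_all add: final_new_def)
  then have "card (labels t) = 18 * n - 29"
    using s(5) card_final_new[OF d] n3 by simp
  moreover have "card C \<le> 3" if "C \<in> ?N" for C
    using that d unfolding final_new_def by (elim UnE) (auto simp: card_clause_parity)
  moreover have "card C \<le> 3" if "C \<in> labels s1 \<union> labels s2" for C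
    using lab[OF that] by auto
  ultimately show ?thesis
    using that[OF t(1)] unfolding t(2) by blast
qed

lemma whd_T: "whd (T v y y' n) = 3" and wid_T: "wid (T v y y' n) = 3"
proof -
  obtain t where t: "refutation (T v y y' n) t" "\<forall>C\<in>labels t. card C \<le> 3"
    using refutation_T by blast
  show "whd (T v y y' n) = 3"
    unfolding whd_def by (rule Least_equality) (use t parent_bounded_if_width whd_lower in blast)+
  \<comment> \<open>The lower bound is inherited from \<open>whd_lower\<close>, because width
    \<open>k\<close> implies \<open>parent_bounded k\<close>.\<close>
  show "wid (T v y y' n) = 3"
    unfolding wid_def by (rule Least_equality) (use t parent_bounded_if_width whd_lower in blast)+
qed

end

subsection \<open>The case \<open>n \<le> 2\<close>\<close>

lemma T_1: "T v y y' 1 = {{Pos (v 1)}, {Neg (v 1)}}"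
  by (simp add: T_def X0_1)

lemma unsat_T_1: "\<not> satisfiable (T v y y' 1)"
  unfolding T_1 satisfiable_def by simp

lemma T_2:
  assumes "v 1 \<noteq> v 2"
  shows "T v y y' 2 = odd2 (v 1) (v 2) \<union> ev2 (v 1) (v 2)"
proof -
  have "{1..2::nat} = {1, 2}" "{1..2 - 1::nat} = {1}" by auto
  then have "T v y y' 2 = X0 {Pos (v 1), Pos (v 2)} \<union> X0 {Pos (v 1), Neg (v 2)}"
    by (simp add: T_def insert_commute)
  then show ?thesis using assms by (simp add: X0_2)
qed

text \<open>The values of \<open>3 * n - 4\<close>, \<open>8 * n - 12\<close> and
  \<open>24 * n - 40\<close> at \<open>n = 2\<close>.\<close>

lemma counts_T_2:
  assumes "v 1 \<noteq> v 2"
  shows "num_vars (T v y y' 2) = 2" "num_clauses (T v y y' 2) = 4" "num_lit_occs (T v y y' 2) = 8"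
    and "C \<in> T v y y' 2 \<Longrightarrow> card C \<le> 3"
proof -
  have disj: "odd2 (v 1) (v 2) \<inter> ev2 (v 1) (v 2) = {}"
    using odd_neg_parity(1,2)[OF assms] by blast
  show "num_vars (T v y y' 2) = 2"
    using assms unfolding num_vars_def T_2[OF assms] by (simp add: parity_defs)
  show "num_clauses (T v y y' 2) = 4"
    unfolding num_clauses_def T_2[OF assms] using assms
    by (subst card_Un_disjoint[OF _ _ disj]) (simp_all add: card_parity)
  have "num_lit_occs (T v y y' 2) = (\<Sum>C\<in>odd2 (v 1) (v 2). 2) + (\<Sum>C\<in>ev2 (v 1) (v 2). 2)"
    unfolding num_lit_occs_def T_2[OF assms] sum.union_disjoint[OF finite_parity(1,2) disj]
    by (intro arg_cong2[of _ _ _ _ "(+)"] sum.cong refl)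
      (simp_all add: card_clause_parity(1,2)[OF _ assms] del: One_nat_def)
  then show "num_lit_occs (T v y y' 2) = 8"
    using assms by (simp add: card_parity)
  show "card C \<le> 3" if "C \<in> T v y y' 2"
    using that assms unfolding T_2[OF assms] by (elim UnE) (simp_all add: card_clause_parity)
qed

text \<open>All four clauses over \<open>v 1\<close> and \<open>v 2\<close> are axioms, so
  \<open>base_tree\<close> applies at once; 4 + 3 clauses agree with
  \<open>18 * 2 - 29\<close>.\<close>

lemma refutation_T_2:
  assumes "v 1 \<noteq> v 2"
  obtains t where "refutation (T v y y' 2) t" "card (labels t) = 7"
proof -
  let ?F = "T v y y' 2" and ?p = "v 1" and ?q = "v 2"
  have F: "resolution_tree ?F (Leaf {Pos ?p, Pos ?q})" "resolution_tree ?F (Leaf {Neg ?p, Neg ?q})"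
    "resolution_tree ?F (Leaf {Pos ?p, Neg ?q})" "resolution_tree ?F (Leaf {Neg ?p, Pos ?q})"
    unfolding T_2[OF assms] parity_defs by simp_all
  obtain t where t: "refutation ?F t" "labels t = labels (Leaf {Pos ?p, Pos ?q}) \<union>
    labels (Leaf {Neg ?p, Neg ?q}) \<union> labels (Leaf {Pos ?p, Neg ?q}) \<union>
    labels (Leaf {Neg ?p, Pos ?q}) \<union> {{Pos ?p}, {Neg ?p}, {}}"
    by (rule base_tree[OF assms F(1) _ F(2) _ F(3) _ F(4)]) simp_all
  let ?W = "odd2 ?p ?q \<union> ev2 ?p ?q" and ?U = "{{Pos ?p}, {Neg ?p}, {}}"
  have "labels t = ?W \<union> ?U"
    unfolding t(2) parity_defs by (intro set_eqI, simp only: label_mem_simps) argo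
  moreover have "?W \<inter> ?U = {}"
  proof -
    have "?q \<in> vars_clause C" if "C \<in> ?W" for C
      using that by (elim UnE) (simp_all add: vars_parity)
    moreover have "?q \<notin> vars_clause C" if "C \<in> ?U" for C
      using that assms by auto
    ultimately show ?thesis by blast
  qed
  then have "card (?W \<union> ?U) = card ?W + card ?U"
    by (intro card_Un_disjoint finite_UnI finite_parity finite.insertI finite.emptyI)
  moreover have "card ?W = 4"
    using counts_T_2(2)[OF assms] unfolding num_clauses_def T_2[OF assms] .
  moreover have "card ?U = 3" by simp
  ultimately have "card (labels t) = 7" by (simp only:)
  then show ?thesis using that t(1) by blast
qed

theorem theorem10p6:
  fixes v y y' :: "nat \<Rightarrow> 'v" and n :: nat
  assumes "n \<ge> 1"
    and "inj_on v {1..n}"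
    and "inj_on y {2..n - 1}" and "inj_on y' {2..n - 1}"
    and "v ` {1..n} \<inter> y ` {2..n - 1} = {}"
    and "v ` {1..n} \<inter> y' ` {2..n - 1} = {}"
    and "y ` {2..n - 1} \<inter> y' ` {2..n - 1} = {}"
  shows "(n \<ge> 2 \<longrightarrow> num_vars (T v y y' n) = 3 * n - 4) \<and>
    (n \<ge> 2 \<longrightarrow> num_clauses (T v y y' n) = 8 * n - 12) \<and>
    (n \<ge> 2 \<longrightarrow> num_lit_occs (T v y y' n) = 24 * n - 40) \<and>
    (\<not> satisfiable (T v y y' n) \<and> (\<forall>C\<in>T v y y' n. card C \<le> 3)) \<and>
    (n \<ge> 3 \<longrightarrow> whd (T v y y' n) = 3 \<and> wid (T v y y' n) = 3) \<and>
    (n \<ge> 2 \<longrightarrow> (\<exists>t. refutation (T v y y' n) t \<and> card (labels t) = 18 * n - 29))"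
proof -
  have "n = 1 \<or> n = 2 \<or> n \<ge> 3" using assms(1) by linarith
  then consider "n = 1" | "n = 2" | "n \<ge> 3" by blast
  then show ?thesis
  proof cases
    case 1
    \<comment> \<open>For \<open>n = 1\<close> only unsatisfiability and the length bound have
      content; the other parts hold vacuously.\<close>
    show ?thesis using unsat_T_1[of v y y'] T_1[of v y y'] unfolding 1 by simp
  next
    case 2
    then have "v 1 \<noteq> v 2" using assms(2) unfolding inj_on_def by force
    obtain t where t: "refutation (T v y y' 2) t" "card (labels t) = 7"
      by (rule refutation_T_2[OF \<open>v 1 \<noteq> v 2\<close>])
    then show ?thesis
      using counts_T_2[OF \<open>v 1 \<noteq> v 2\<close>] refutation_unsat[OF t(1)] unfolding 2 by auto
  next
    case 3
    then interpret T_vars v y y' n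
      using assms by unfold_locales
    obtain t where "refutation (T v y y' n) t" "card (labels t) = 18 * n - 29"
      by (rule refutation_T)
    then show ?thesis
      using 3 num_vars_T num_clauses_T num_lit_occs_T refutation_unsat card_clause_T whd_T wid_T
      by blast
  qed
qed

end
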